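(* Let $p_0$ be an odd prime, $p$ a power of $p_0$, and $R(x) = 2x^p + x$. Let $\alpha \in \mathbb{F}_p^{\times} \setminus \{-1\}$ and set $\beta = -(\alpha(\alpha+1))^{-1} \in \mathbb{F}_p^\times$. Let $\xi, \zeta \in \mathbb{F}^{\times}$ satisfy $\xi^{p-1} = \alpha$ and $\zeta^{p-1} = \beta$. Let $d_1$ be the order of $\alpha$ in $\mathbb{F}_p^{\times}$, $d_2$ the order of $\beta$ in $\mathbb{F}_p^{\times}$, and $d = \mathrm{lcm}(d_1, d_2)$. Let $\overline{C}_{\zeta R}$ be the smooth projective compactification of the affine curve $y^p - y = \zeta x R(x) = 2\zeta x^{p+1} + \zeta x^2$, defined over $\mathbb{F}_p(\zeta)$. (1) If $d$ is odd and $p \equiv 3 \pmod 4$, then $\overline{C}_{\zeta R}$ is $\mathbb{F}_{p^{2p_0 d}}$-maximal. (2) If $d$ is even and $\beta^{d/2} = -1$, then $\overline{C}_{\zeta R}$ is $\mathbb{F}_{p^{p_0 d}}$-maximal.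
   Context: $\mathbb{F}$ denotes an algebraic closure of $\mathbb{F}_{p_0}$; one has $\zeta \in \mathbb{F}_{p^d}$. The curve $\overline{C}_{\zeta R}$ is geometrically connected, smooth, projective of genus $g = p(p-1)/2$. For a power $Q$ of $p$ with $\mathbb{F}_p(\zeta) \subset \mathbb{F}_Q$, the curve is called $\mathbb{F}_Q$-maximal if $|\overline{C}_{\zeta R}(\mathbb{F}_Q)| = Q + 1 + 2gQ^{1/2}$. *)

theory Defs
  imports "HOL-Algebra.Multiplicative_Group" "HOL-Computational_Algebra.Computational_Algebra"
begin

text \<open>
  The class \<open>alg_closed_field\<close> provides an algebraically closed field; together with the next
  predicate it is an algebraic closure of its prime field.  In characteristic \<open>p0 > 0\<close> the set
  \<open>\<int>\<close> is the prime field, so the formula is the one of the library constant \<open>algebraic\<close>,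
  which is only available in characteristic zero.
\<close>

definition algebraic_over_prime_field :: "'a :: field itself \<Rightarrow> bool" where
  "algebraic_over_prime_field _ \<longleftrightarrow>
     (\<forall>x :: 'a. \<exists>P. (\<forall>i. coeff P i \<in> \<int>) \<and> P \<noteq> 0 \<and> poly P x = 0)"

text \<open>For a power \<open>q > 1\<close> of the characteristic, this is the unique subfield with \<open>q\<close> elements.\<close>

definition GF :: "nat \<Rightarrow> 'a :: field set" where
  "GF q = {x. x ^ q = x}"

definition GF_units :: "nat \<Rightarrow> 'a :: field monoid" where
  "GF_units q = \<lparr>carrier = GF q - {0}, monoid.mult = (*), one = 1\<rparr>"


section \<open>Plane curves and their projective closures\<close>

text \<open>
  A polynomial \<open>f(x, y)\<close> is an element of \<open>'a poly poly\<close> and a polynomial \<open>F(X, Y, Z)\<close> one of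
  \<open>'a poly poly poly\<close>.  The innermost variable is \<open>x\<close> (resp. \<open>X\<close>), the outermost one is \<open>y\<close>
  (resp. \<open>Z\<close>): \<open>monom (monom (monom c i) j) k\<close> is \<open>c X^i Y^j Z^k\<close>.
\<close>

definition eval2 :: "'a :: comm_ring_1 poly poly \<Rightarrow> 'a \<Rightarrow> 'a \<Rightarrow> 'a" where
  "eval2 f x y = poly (poly f [:y:]) x"

definition eval3 :: "'a :: comm_ring_1 poly poly poly \<Rightarrow> 'a \<Rightarrow> 'a \<Rightarrow> 'a \<Rightarrow> 'a" where
  "eval3 F x y z = eval2 (poly F [:[:z:]:]) x y"

definition supp2 :: "'a :: zero poly poly \<Rightarrow> (nat \<times> nat) set" where
  "supp2 f = {(i, j). coeff (coeff f j) i \<noteq> 0}"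

definition total_degree :: "'a :: zero poly poly \<Rightarrow> nat" where
  "total_degree f = Max ((\<lambda>(i, j). i + j) ` supp2 f)"

definition homogenization :: "'a :: comm_ring_1 poly poly \<Rightarrow> 'a poly poly poly" where
  "homogenization f =
     (\<Sum>(i, j)\<in>supp2 f. monom (monom (monom (coeff (coeff f j) i) i) j) (total_degree f - (i + j)))"

definition homogeneous :: "nat \<Rightarrow> 'a :: zero poly poly poly \<Rightarrow> bool" where
  "homogeneous n F \<longleftrightarrow> (\<forall>i j k. coeff (coeff (coeff F k) j) i \<noteq> 0 \<longrightarrow> i + j + k = n)"

text \<open>Jacobian criterion; the three polynomials are the partial derivatives by \<open>X\<close>, \<open>Y\<close>, \<open>Z\<close>.\<close>

definition smooth_plane_curve :: "'a :: alg_closed_field poly poly poly \<Rightarrow> bool" where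
  "smooth_plane_curve F \<longleftrightarrow>
     (\<forall>x y z. (x, y, z) \<noteq> (0, 0, 0) \<and> eval3 F x y z = 0 \<longrightarrow>
        eval3 (map_poly (map_poly pderiv) F) x y z \<noteq> 0 \<or>
        eval3 (map_poly pderiv F) x y z \<noteq> 0 \<or>
        eval3 (pderiv F) x y z \<noteq> 0)"

definition proj_point :: "'a :: field \<Rightarrow> 'a \<Rightarrow> 'a \<Rightarrow> ('a \<times> 'a \<times> 'a) set" where
  "proj_point x y z = {(c * x, c * y, c * z) |c. c \<noteq> 0}"

text \<open>The points over the field with \<open>q\<close> elements of the curve \<open>F = 0\<close> in the projective plane.\<close>

definition rational_points ::
  "'a :: field poly poly poly \<Rightarrow> nat \<Rightarrow> ('a \<times> 'a \<times> 'a) set set" where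
  "rational_points F q =
     {proj_point x y z |x y z.
        x \<in> GF q \<and> y \<in> GF q \<and> z \<in> GF q \<and> (x, y, z) \<noteq> (0, 0, 0) \<and> eval3 F x y z = 0}"


section \<open>The curve \<open>y^p - y = \<zeta> x R(x)\<close>\<close>

definition R_poly :: "nat \<Rightarrow> 'a :: comm_ring_1 poly" where
  "R_poly p = smult 2 (monom 1 p) + monom 1 1"

definition affine_curve :: "nat \<Rightarrow> 'a :: comm_ring_1 \<Rightarrow> 'a poly poly" where
  "affine_curve p \<zeta> = monom 1 p - monom 1 1 - [: smult \<zeta> (monom 1 1 * R_poly p) :]"

text \<open>
  The closure of the affine curve in the projective plane is already smooth (see
  \<open>smooth_complete_curve\<close> below), hence it is the smooth projective compactification.
\<close>

definition complete_curve :: "nat \<Rightarrow> 'a :: comm_ring_1 \<Rightarrow> 'a poly poly poly" where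
  "complete_curve p \<zeta> = homogenization (affine_curve p \<zeta>)"

text \<open>
  As \<open>GF Q\<close> is a field, the first two conjuncts say that \<open>Q\<close> is a power of \<open>p\<close> and that
  \<open>GF Q\<close> contains the field generated by \<open>\<zeta>\<close> over \<open>GF p\<close>.  The genus is \<open>p (p - 1) / 2\<close>,
  that of a smooth plane curve of degree \<open>p + 1\<close>.
\<close>

definition maximal_curve :: "nat \<Rightarrow> 'a :: alg_closed_field \<Rightarrow> nat \<Rightarrow> bool" where
  "maximal_curve p \<zeta> Q \<longleftrightarrow>
     (\<exists>m>0. Q = p ^ m) \<and> insert \<zeta> (GF p) \<subseteq> GF Q \<and>
     (let g = real p * (real p - 1) / 2 in
      real (card (rational_points (complete_curve p \<zeta>) Q)) = real Q + 1 + 2 * g * sqrt (real Q))"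


subsection \<open>The complete curve is a smooth projective compactification\<close>

lemma eval2_affine_curve: "eval2 (affine_curve p \<zeta>) x y = y ^ p - y - \<zeta> * x * poly (R_poly p) x"
  by (simp add: eval2_def affine_curve_def poly_monom)

lemma coeff_affine_curve:
  fixes \<zeta> :: "'a :: field"
  assumes "p > 1"
  shows "coeff (coeff (affine_curve p \<zeta>) j) i =
    (if j = p \<and> i = 0 then 1 else if j = 1 \<and> i = 0 then - 1
     else if j = 0 \<and> i = p + 1 then - (2 * \<zeta>) else if j = 0 \<and> i = 2 then - \<zeta> else 0)"
proof (cases j)
  case 0
  have "monom 1 1 * R_poly p = monom (2 :: 'a) (p + 1) + monom 1 2"
    by (simp add: R_poly_def ring_distribs smult_monom mult_monom numeral_2_eq_2)
  then show ?thesis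
    using assms 0 by (auto simp: affine_curve_def)
next
  case (Suc m)
  then show ?thesis
    using assms by (auto simp: affine_curve_def coeff_pCons)
qed

lemma supp2_affine_curve:
  fixes \<zeta> :: "'a :: field"
  assumes "\<zeta> \<noteq> 0" "(2 :: 'a) \<noteq> 0" "p > 1"
  shows "supp2 (affine_curve p \<zeta>) = {(0, p), (0, 1), (p + 1, 0), (2, 0)}"
  using assms by (auto simp: supp2_def coeff_affine_curve split: if_splits)

lemma total_degree_affine_curve:
  fixes \<zeta> :: "'a :: field"
  assumes "\<zeta> \<noteq> 0" "(2 :: 'a) \<noteq> 0" "p > 1"
  shows "total_degree (affine_curve p \<zeta>) = p + 1"
  using assms by (simp add: total_degree_def supp2_affine_curve)

lemma complete_curve_eq:
  fixes \<zeta> :: "'a :: field"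
  assumes "\<zeta> \<noteq> 0" "(2 :: 'a) \<noteq> 0" "p > 1"
  shows "complete_curve p \<zeta> =
    monom (monom (monom 1 0) p) 1 + monom (monom (monom (- 1) 0) 1) p
    + (monom (monom (monom (- (2 * \<zeta>)) (p + 1)) 0) 0 + monom (monom (monom (- \<zeta>) 2) 0) (p - 1))"
  using assms
  by (simp add: complete_curve_def homogenization_def total_degree_affine_curve supp2_affine_curve
                coeff_affine_curve)

lemma eval3_add: "eval3 (F + G) x y z = eval3 F x y z + eval3 G x y z"
  by (simp add: eval3_def eval2_def)

lemma eval3_monom: "eval3 (monom (monom (monom c i) j) k) x y z = c * x ^ i * y ^ j * z ^ k"
  by (simp add: eval3_def eval2_def poly_monom flip: pCons_one)

lemma eval3_monom_1: "eval3 (monom (monom 1 j) k) x y z = y ^ j * z ^ k"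
  using eval3_monom[of 1 0] by simp

lemma eval3_complete_curve:
  fixes \<zeta> :: "'a :: field"
  assumes "\<zeta> \<noteq> 0" "(2 :: 'a) \<noteq> 0" "p > 1"
  shows "eval3 (complete_curve p \<zeta>) x y z =
    y ^ p * z - y * z ^ p - 2 * \<zeta> * x ^ (p + 1) - \<zeta> * x\<^sup>2 * z ^ (p - 1)"
  using assms by (simp add: complete_curve_eq eval3_add eval3_monom eval3_monom_1)

lemma homogeneous_complete_curve:
  fixes \<zeta> :: "'a :: field"
  assumes "\<zeta> \<noteq> 0" "(2 :: 'a) \<noteq> 0" "p > 1"
  shows "homogeneous (p + 1) (complete_curve p \<zeta>)"
  unfolding homogeneous_def complete_curve_eq[OF assms]
  using assms by (auto split: if_splits)

lemma dehomogenize_complete_curve: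
  fixes \<zeta> :: "'a :: field"
  assumes "\<zeta> \<noteq> 0" "(2 :: 'a) \<noteq> 0" "p > 1"
  shows "poly (complete_curve p \<zeta>) 1 = affine_curve p \<zeta>"
proof -
  have "coeff (coeff (poly (complete_curve p \<zeta>) 1) j) i = coeff (coeff (affine_curve p \<zeta>) j) i"
    for i j
    using assms by (auto simp: complete_curve_eq poly_monom coeff_affine_curve)
  then show ?thesis
    by (intro poly_eqI)
qed

lemma map_poly_pderiv_add: "map_poly pderiv (F + G) = map_poly pderiv F + map_poly pderiv G"
  by (intro poly_eqI) (simp add: coeff_map_poly pderiv_add)

lemma map_poly_map_poly_pderiv_add:
  "map_poly (map_poly pderiv) (F + G) = map_poly (map_poly pderiv) F + map_poly (map_poly pderiv) G"
  by (intro poly_eqI) (simp add: coeff_map_poly map_poly_pderiv_add pderiv_add)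

lemma smooth_complete_curve:
  fixes \<zeta> :: "'a :: alg_closed_field"
  assumes "\<zeta> \<noteq> 0" "(2 :: 'a) \<noteq> 0" "p > 2" "of_nat p = (0 :: 'a)"
  shows "smooth_plane_curve (complete_curve p \<zeta>)"
proof -
  have eq: "complete_curve p \<zeta> =
    monom (monom (monom 1 0) p) 1 + monom (monom (monom (- 1) 0) 1) p
    + (monom (monom (monom (- (2 * \<zeta>)) (p + 1)) 0) 0 + monom (monom (monom (- \<zeta>) 2) 0) (p - 1))"
    using assms by (intro complete_curve_eq) auto
  have p0: "of_nat p = (0 :: 'a poly poly)"
    using assms by (simp add: of_nat_poly)
  then have p1: "of_nat (p - 1) = (- 1 :: 'a poly poly)"
    using assms by (simp add: of_nat_diff)
  have X: "eval3 (map_poly (map_poly pderiv) (complete_curve p \<zeta>)) x y z =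
      - (2 * \<zeta>) * x ^ p - 2 * \<zeta> * x * z ^ (p - 1)" for x y z
    using assms unfolding eq
    by (simp add: map_poly_map_poly_pderiv_add map_poly_monom pderiv_monom eval3_add eval3_monom)
  have Y: "eval3 (map_poly pderiv (complete_curve p \<zeta>)) x y z = - (z ^ p)" for x y z
    using assms unfolding eq
    by (simp add: map_poly_pderiv_add map_poly_monom pderiv_monom eval3_add eval3_monom of_nat_poly)
  have Z: "eval3 (pderiv (complete_curve p \<zeta>)) x y z = y ^ p + \<zeta> * x\<^sup>2 * z ^ (p - 2)" for x y z
    using assms unfolding eq pderiv_add pderiv_monom p0 p1
    by (simp add: eval3_add eval3_monom eval3_monom_1 minus_monom numeral_2_eq_2)
  show ?thesis
    unfolding smooth_plane_curve_def X Y Z using assms by (auto simp: power_0_left)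
qed


subsection \<open>The field \<open>GF q\<close> and its group of units\<close>

lemma card_GF:
  assumes "CHAR('a :: alg_closed_field) > 0" "q = CHAR('a) ^ n" "n > 0"
  shows "card (GF q :: 'a set) = q"
proof -
  have "prime CHAR('a)"
    using assms(1) prime_CHAR_semidom by blast
  then have q: "q > 1"
    unfolding assms(2) using assms(3) by (intro one_less_power prime_gt_1_nat)
  define P :: "'a poly" where "P = monom 1 q - monom 1 1"
  have "degree P = q"
    unfolding P_def diff_conv_add_uminus using q
    by (subst degree_add_eq_left) (simp_all add: degree_monom_eq)
  then have "P \<noteq> 0"
    using q by auto
  have "of_nat q = (0 :: 'a)"
    using assms by (simp add: of_nat_eq_0_iff_char_dvd)
  then have dP: "pderiv P = - 1"
    by (simp add: P_def pderiv_diff pderiv_monom)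
  have order: "order a P \<le> 1" for a
  proof (rule ccontr)
    assume "\<not> order a P \<le> 1"
    then have "[:- a, 1:] ^ 2 dvd P"
      using order_divides[of a 2 P] by simp
    then obtain S where "P = [:- a, 1:] * ([:- a, 1:] * S)"
      unfolding power2_eq_square dvd_def mult.assoc by blast
    then have "poly (pderiv P) a = 0"
      by (simp only: pderiv_mult poly_add poly_mult) simp
    then show False
      by (simp add: dP)
  qed
  obtain A where A: "size A = degree P" "P = smult (lead_coeff P) (\<Prod>x\<in>#A. [:- x, 1:])"
    using alg_closed_imp_factorization \<open>P \<noteq> 0\<close> by blast
  have "proots (\<Prod>x\<in>#A. [:- x, 1:]) = A"
  proof (induction A)
    case (add x A)
    have "(\<Prod>x\<in>#A. [:- x, 1:]) \<noteq> (0 :: 'a poly)"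
      by (auto simp: prod_mset_zero_iff)
    then have "proots ([:- x, 1:] * (\<Prod>x\<in>#A. [:- x, 1:])) = add_mset x A"
      using add by (subst proots_mult) auto
    then show ?case
      by simp
  qed simp
  then have "proots P = A"
    using \<open>P \<noteq> 0\<close> A(2) by (metis leading_coeff_0_iff proots_smult)
  then have "q = size (proots P)"
    using A(1) \<open>degree P = q\<close> by simp
  also have "\<dots> = (\<Sum>a\<in>{x. poly P x = 0}. order a P)"
    using \<open>P \<noteq> 0\<close> by (simp add: size_multiset_overloaded_eq)
  also have "\<dots> = (\<Sum>a\<in>{x. poly P x = 0}. 1)"
  proof (intro sum.cong refl)
    fix a
    assume "a \<in> {x. poly P x = 0}"
    then have "order a P \<noteq> 0"
      using \<open>P \<noteq> 0\<close> order_root by blast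
    then show "order a P = 1"
      using order[of a] by linarith
  qed
  also have "{x. poly P x = 0} = GF q"
    by (auto simp: P_def GF_def poly_monom)
  finally show ?thesis
    by simp
qed

lemma group_GF_units: "group (GF_units q :: 'a :: field monoid)"
proof (rule groupI)
  fix x :: 'a
  assume "x \<in> carrier (GF_units q)"
  then show "\<exists>y\<in>carrier (GF_units q). y \<otimes>\<^bsub>GF_units q\<^esub> x = \<one>\<^bsub>GF_units q\<^esub>"
    by (intro bexI[of _ "inverse x"]) (auto simp: GF_units_def GF_def power_inverse)
qed (auto simp: GF_units_def GF_def power_mult_distrib)

end

theory Submission
  imports Defs
begin

text \<open>
  Write \<open>Q = p^n\<close> and \<open>n = 2 m\<close>.  A substitution turns the curve into
  \<open>y^p - y = \<gamma> (t^p - t)\<^sup>2\<close> with \<open>\<gamma> = - \<zeta> \<alpha> \<xi>\<^sup>2\<close>.  By additive Hilbert 90 it has \<open>p\<^sup>2\<close> times as many affine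
  points over \<open>GF Q\<close> as there are \<open>s\<close> of trace \<open>0\<close> with \<open>Tr (\<gamma> s\<^sup>2) = 0\<close>.  The hyperplane \<open>Tr s = 0\<close>
  is the orthogonal complement of \<open>1 / \<gamma>\<close>, which is isotropic for the quadratic form
  \<open>Tr (\<gamma> s\<^sup>2)\<close>: this is where the factor \<open>p0\<close> of \<open>n\<close> matters, as \<open>\<gamma>\<close> lies in \<open>GF p\<close> when
  \<open>2 \<alpha> = - 1\<close>.  The form is hyperbolic: for \<open>e = 1\<close>, resp. \<open>e = 1 + i\<close> with \<open>i\<^sup>2 = - 1\<close>, the element
  \<open>\<gamma> e\<^sup>2\<close> changes sign under the Frobenius of order two, so \<open>e GF (p^m)\<close> is a maximal isotropic
  subspace.  The zeros are then counted on the cosets of these isotropic subspaces.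
\<close>

text \<open>On \<open>GF (p ^ n)\<close>, for p a power of the characteristic, this is the field
  trace down to \<open>GF p\<close>. As a formula on the whole ambient field it is additive without
  any membership condition.\<close>

definition frob_trace :: "nat \<Rightarrow> nat \<Rightarrow> 'a :: field \<Rightarrow> 'a" where
  "frob_trace p n x = (\<Sum>i<n. x ^ (p ^ i))"

section \<open>Fixed fields, Frobenius eigenvectors and subspaces\<close>

lemma GF_mult: "x \<in> GF q \<Longrightarrow> y \<in> GF q \<Longrightarrow> x * y \<in> GF q"
  by (simp add: GF_def power_mult_distrib)

lemma GF_divide: "x \<in> GF q \<Longrightarrow> y \<in> GF q \<Longrightarrow> x / y \<in> GF q"
  by (simp add: GF_def power_divide)

lemma GF_power: "x \<in> GF q \<Longrightarrow> x ^ n \<in> GF q"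
  by (simp add: GF_def flip: power_mult) (metis mult.commute power_mult)

lemma GF_one: "1 \<in> GF q"
  by (simp add: GF_def)

text \<open>The eigenvalue \<mu> is itself fixed by the p-th power map, so each iteration
  contributes one more factor \<mu>. Since \<xi>, \<zeta>, \<gamma> and i are all such eigenvectors,
  the powers of their eigenvalues decide in which \<open>GF (p ^ n)\<close> they lie.\<close>

lemma power_frob_eigen:
  fixes z \<mu> :: "'a :: field"
  assumes "z ^ p = \<mu> * z" "\<mu> \<in> GF p"
  shows "z ^ (p ^ n) = \<mu> ^ n * z"
proof (induction n)
  case (Suc n)
  have "z ^ (p ^ Suc n) = (z ^ (p ^ n)) ^ p"
    by (metis mult.commute power_Suc power_mult)
  also have "\<dots> = \<mu> ^ n * (\<mu> * z)"
    using GF_power[OF assms(2), of n] Suc assms(1) by (simp add: power_mult_distrib GF_def)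
  finally show ?case
    by simp
qed simp

lemma GF_subset_GF_power: "GF p \<subseteq> GF (p ^ n)"
  \<comment> \<open>Elements of \<open>GF p\<close> are the eigenvectors with eigenvalue 1.\<close>
  using power_frob_eigen[of _ p 1 n] GF_one[of p] by (auto simp: GF_def)

text \<open>Negation is covered by the scalar -1, which lies in \<open>GF p\<close> when p is a
  power of the characteristic.\<close>

definition GF_subspace :: "nat \<Rightarrow> 'a :: field set \<Rightarrow> bool" where
  "GF_subspace p V \<longleftrightarrow> 0 \<in> V \<and> (\<forall>x\<in>V. \<forall>y\<in>V. x + y \<in> V) \<and> (\<forall>t\<in>GF p. \<forall>x\<in>V. t * x \<in> V)"

lemma GF_subspace_scale:
  assumes "GF_subspace p V"
  shows "GF_subspace p ((*) e ` V)"
proof -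
  have "e * 0 \<in> (*) e ` V" "e * (x + y) \<in> (*) e ` V" "e * (t * x) \<in> (*) e ` V"
    if "x \<in> V" "y \<in> V" "t \<in> GF p" for x y t
    using assms that unfolding GF_subspace_def by blast+
  moreover have "0 \<in> V"
    using assms by (simp add: GF_subspace_def)
  ultimately show ?thesis
    unfolding GF_subspace_def ball_simps
    by (simp add: distrib_left mult.left_commute[of e]) (metis GF_one)
qed

section \<open>Rational points: affine part and infinity\<close>

lemma proj_point_scale:
  assumes "c \<noteq> 0"
  shows "proj_point (c * x) (c * y) (c * z) = proj_point x y z"
proof -
  have "{(a * (c * x), a * (c * y), a * (c * z)) |a. a \<noteq> 0} = {(a * x, a * y, a * z) |a. a \<noteq> 0}"
    (is "?L = ?R")
  proof
    show "?L \<subseteq> ?R"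
      using assms by (auto simp: mult.assoc[symmetric])
    show "?R \<subseteq> ?L"
    proof
      fix u
      assume "u \<in> ?R"
      then obtain a where "u = (a * x, a * y, a * z)" "a \<noteq> 0"
        by auto
      then show "u \<in> ?L"
        using assms by (intro CollectI exI[of _ "a / c"]) simp
    qed
  qed
  then show ?thesis
    by (simp add: proj_point_def)
qed

lemma proj_point_self: "(x, y, z) \<in> proj_point x y z"
  unfolding proj_point_def by (intro CollectI exI[of _ 1]) simp

text \<open>At z = 0 the equation reduces to 2 \<zeta> x^(p+1) = 0, so (0 : 1 : 0) is the only point
  at infinity. All other points can be normalised to z = 1.\<close>

lemma card_rational_points:
  fixes \<zeta> :: "'a :: field"
  assumes \<zeta>: "\<zeta> \<noteq> 0" and two: "(2 :: 'a) \<noteq> 0" and p: "p > 1" and q: "q > 0" and fin: "finite (GF q :: 'a set)"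
  shows "card (rational_points (complete_curve p \<zeta>) q) =
    card {(x, y). x \<in> GF q \<and> y \<in> GF q \<and> y ^ p - y = 2 * \<zeta> * x ^ (p + 1) + \<zeta> * x\<^sup>2} + 1"
proof -
  let ?F = "complete_curve p \<zeta>"
  let ?A = "{(x, y). x \<in> GF q \<and> y \<in> GF q \<and> y ^ p - y = 2 * \<zeta> * x ^ (p + 1) + \<zeta> * x\<^sup>2}"
  let ?f = "\<lambda>(x, y). proj_point x y 1 :: ('a \<times> 'a \<times> 'a) set"
  note ev = eval3_complete_curve[OF \<zeta> two p]
  have affine: "eval3 ?F x y 1 = 0 \<longleftrightarrow> y ^ p - y = 2 * \<zeta> * x ^ (p + 1) + \<zeta> * x\<^sup>2" for x y
    unfolding ev by (auto simp: algebra_simps)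
  \<comment> \<open>Homogeneity, read off from the explicit equation. The exponent p - 1 is a
    truncated difference, hence the separate treatment of that term.\<close>
  have scale: "eval3 ?F (c * x) (c * y) (c * z) = c ^ (p + 1) * eval3 ?F x y z" for c x y z
  proof -
    have "c ^ 2 * c ^ (p - 1) = c ^ (p + 1)"
      using p by (simp flip: power_add)
    moreover have "\<zeta> * (c * x)\<^sup>2 * (c * z) ^ (p - 1) = c ^ 2 * c ^ (p - 1) * (\<zeta> * x\<^sup>2 * z ^ (p - 1))"
      by (simp only: power_mult_distrib ac_simps)
    ultimately have "\<zeta> * (c * x)\<^sup>2 * (c * z) ^ (p - 1) = c ^ (p + 1) * (\<zeta> * x\<^sup>2 * z ^ (p - 1))"
      by (simp only:)
    then show ?thesis
      unfolding ev by (simp only:) (simp add: power_mult_distrib algebra_simps)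
  qed
  have "rational_points ?F q = insert (proj_point 0 1 0) (?f ` ?A)"
  proof
    show "rational_points ?F q \<subseteq> insert (proj_point 0 1 0) (?f ` ?A)"
    proof
      fix P
      assume "P \<in> rational_points ?F q"
      then obtain x y z where P: "P = proj_point x y z" "x \<in> GF q" "y \<in> GF q" "z \<in> GF q"
          "(x, y, z) \<noteq> (0, 0, 0)" "eval3 ?F x y z = 0"
        by (auto simp: rational_points_def)
      show "P \<in> insert (proj_point 0 1 0) (?f ` ?A)"
      proof (cases "z = 0")
        case True
        then have "x = 0"
          using P(6) \<zeta> two p by (simp add: ev power_0_left)
        then have "P = proj_point 0 1 0"
          using P(1,5) True proj_point_scale[of y 0 1 0] by simp
        then show ?thesis
          by simp
      next
        case False
        have "eval3 ?F (x / z) (y / z) 1 = 0"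
          using scale[of z "x / z" "y / z" 1] False P(6) by simp
        then have "(x / z, y / z) \<in> ?A"
          using P(2-4) affine by (auto intro: GF_divide)
        moreover have "P = ?f (x / z, y / z)"
          using proj_point_scale[OF False, of "x / z" "y / z" 1] False P(1) by simp
        ultimately show ?thesis
          by blast
      qed
    qed
    have "proj_point 0 1 0 \<in> rational_points ?F q"
      unfolding rational_points_def using q p
      by (intro CollectI exI[of _ 0] exI[of _ 1]) (simp add: ev GF_def power_0_left)
    moreover have "?f ` ?A \<subseteq> rational_points ?F q"
      using affine GF_one[of q] by (fastforce simp: rational_points_def)
    ultimately show "insert (proj_point 0 1 0) (?f ` ?A) \<subseteq> rational_points ?F q"
      by simp
  qed
  \<comment> \<open>Two representatives with last coordinate 1 can differ only by the scalar
    1.\<close>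
  moreover have "inj_on ?f ?A"
  proof (rule inj_onI)
    fix a b
    assume "?f a = ?f b"
    then have "(fst a, snd a, 1) \<in> proj_point (fst b) (snd b) 1"
      using proj_point_self[of "fst a" "snd a" 1] by (simp add: case_prod_beta)
    then show "a = b"
      by (auto simp: proj_point_def prod_eq_iff)
  qed
  moreover have "proj_point 0 1 0 \<notin> ?f ` ?A"
  proof
    assume "proj_point 0 1 0 \<in> ?f ` ?A"
    then obtain x y :: 'a where "proj_point 0 1 0 = proj_point x y 1"
      by auto
    then have "(x, y, 1) \<in> proj_point 0 1 0"
      using proj_point_self[of x y 1] by simp
    then show False
      by (auto simp: proj_point_def)
  qed
  moreover have "finite ?A"
    by (rule finite_subset[OF _ finite_cartesian_product[OF fin fin]]) auto
  ultimately show ?thesis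
    by (simp add: card_image)
qed

section \<open>Arithmetic of Frobenius and of the fields \<open>GF (p ^ n)\<close>\<close>

context
  fixes p k :: nat
  assumes char_pos: "CHAR('a :: alg_closed_field) > 0"
    and p_eq: "p = CHAR('a) ^ k" and k_pos: "k > 0"
begin

lemma p_gt_1: "p > 1"
  unfolding p_eq using k_pos prime_gt_1_nat[OF prime_CHAR_semidom[OF char_pos]]
  by (intro one_less_power)

lemma frob_add: "(x + y :: 'a) ^ (p ^ n) = x ^ (p ^ n) + y ^ (p ^ n)"
  using freshmans_dream'[OF prime_CHAR_semidom[OF char_pos], of "p ^ n" "k * n" x y]
  by (simp add: p_eq power_mult)

lemma frob_diff: "(x - y :: 'a) ^ (p ^ n) = x ^ (p ^ n) - y ^ (p ^ n)"
  using frob_add[of "x - y" y n] by (simp add: algebra_simps)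

lemma frob_minus: "(- x :: 'a) ^ (p ^ n) = - (x ^ (p ^ n))"
  using frob_diff[of 0 x n] p_gt_1 by (simp add: power_0_left)

lemma GF_add: "x \<in> GF (p ^ n) \<Longrightarrow> y \<in> GF (p ^ n) \<Longrightarrow> x + y \<in> (GF (p ^ n) :: 'a set)"
  by (simp add: GF_def frob_add)

lemma GF_diff: "x \<in> GF (p ^ n) \<Longrightarrow> y \<in> GF (p ^ n) \<Longrightarrow> x - y \<in> (GF (p ^ n) :: 'a set)"
  by (simp add: GF_def frob_diff)

lemma GF_minus: "x \<in> GF (p ^ n) \<Longrightarrow> - x \<in> (GF (p ^ n) :: 'a set)"
  by (simp add: GF_def frob_minus)

lemma GF_zero: "0 \<in> (GF (p ^ n) :: 'a set)"
  using p_gt_1 by (simp add: GF_def)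

lemma GF_two: "2 \<in> (GF (p ^ n) :: 'a set)"
  using GF_add[OF GF_one GF_one] by simp

lemmas GF_p_closed = GF_add[of _ 1, simplified] GF_diff[of _ 1, simplified]
  GF_minus[of _ 1, simplified] GF_zero[of 1, simplified]

lemma card_GF_power: "n > 0 \<Longrightarrow> card (GF (p ^ n) :: 'a set) = p ^ n"
  using card_GF[OF char_pos, of "p ^ n" "k * n"] k_pos by (simp add: p_eq power_mult)

lemma card_GF_p: "card (GF p :: 'a set) = p"
  using card_GF_power[of 1] by simp

lemma finite_GF_power: "n > 0 \<Longrightarrow> finite (GF (p ^ n) :: 'a set)"
  using card_GF_power[of n] p_gt_1 by (intro card_ge_0_finite) simp

lemma finite_GF_p: "finite (GF p :: 'a set)"
  using finite_GF_power[of 1] by simp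

lemma GF_subspace_GF: "GF_subspace p (GF (p ^ n) :: 'a set)"
  using GF_subset_GF_power[of p n]
  by (auto simp: GF_subspace_def GF_zero intro: GF_add GF_mult)

section \<open>The trace and additive Hilbert 90\<close>

lemma frob_trace_add: "frob_trace p n (x + y :: 'a) = frob_trace p n x + frob_trace p n y"
  by (simp add: frob_trace_def frob_add sum.distrib)

lemma frob_trace_0: "frob_trace p n (0 :: 'a) = 0"
  using p_gt_1 by (simp add: frob_trace_def power_0_left)

lemma frob_trace_scale:
  assumes "t \<in> GF p"
  shows "frob_trace p n (t * x :: 'a) = t * frob_trace p n x"
proof -
  have "t ^ (p ^ i) = t" for i
    using assms GF_subset_GF_power[of p i] by (auto simp: GF_def)
  then show ?thesis
    by (simp add: frob_trace_def power_mult_distrib sum_distrib_left)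
qed

lemma frob_trace_frob_diff: "frob_trace p n (y ^ p - y :: 'a) = y ^ (p ^ n) - y"
proof -
  have "frob_trace p n (y ^ p - y) = (\<Sum>i<n. y ^ (p ^ Suc i) - y ^ (p ^ i))"
    by (simp add: frob_trace_def frob_diff power_mult)
  also have "\<dots> = y ^ (p ^ n) - y"
    by (subst sum_lessThan_telescope) simp
  finally show ?thesis .
qed

text \<open>Raising to the p-th power shifts the index of the sum by one, so the difference
  telescopes to x^(p^n) - x = 0.\<close>

lemma frob_trace_in_GF:
  assumes "x \<in> GF (p ^ n)"
  shows "frob_trace p n (x :: 'a) \<in> GF p"
proof -
  have frob_sum: "(\<Sum>i\<in>I. h i) ^ p = (\<Sum>i\<in>I. h i ^ p)" if "finite I" for h :: "nat \<Rightarrow> 'a" and I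
    using that
  proof (induction I rule: finite_induct)
    case empty
    then show ?case
      using p_gt_1 by simp
  next
    case (insert i I)
    then show ?case
      using frob_add[of "h i" "sum h I" 1] by simp
  qed
  have "frob_trace p n x ^ p - frob_trace p n x = (\<Sum>i<n. x ^ (p ^ Suc i) - x ^ (p ^ i))"
    by (simp add: frob_trace_def frob_sum sum_subtractf mult.commute flip: power_mult)
  also have "\<dots> = 0"
    using assms by (subst sum_lessThan_telescope) (simp add: GF_def)
  finally show ?thesis
    by (simp add: GF_def)
qed

text \<open>Transitivity of the trace: on \<open>GF (p ^ (2 * m))\<close>, x + x^(p^m) is the
  relative trace to \<open>GF (p ^ m)\<close>. Elements whose sign is changed by the p^m-power map
  thus have trace 0.\<close>

lemma frob_trace_double: "frob_trace p (2 * m) (x :: 'a) = frob_trace p m (x + x ^ (p ^ m))"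
proof -
  have split: "(\<Sum>i<m + l. h i) = (\<Sum>i<m. h i) + (\<Sum>i<l. h (m + i))" for l and h :: "nat \<Rightarrow> 'a"
    by (induction l) (simp_all add: add.assoc)
  have "frob_trace p (2 * m) x = (\<Sum>i<m + m. x ^ (p ^ i))"
    by (simp add: frob_trace_def mult_2)
  also have "\<dots> = (\<Sum>i<m. x ^ (p ^ i)) + (\<Sum>i<m. x ^ (p ^ (m + i)))"
    by (rule split)
  finally show ?thesis
    by (simp add: frob_trace_def frob_add sum.distrib power_add power_mult)
qed

text \<open>The trace is z times a geometric sum in \<mu>. For \<mu> different from 1 this sum
  vanishes by \<mu>^n = 1; for \<mu> = 1 it equals n, which is why n must be divisible by the
  characteristic.\<close>

lemma frob_trace_eigen:
  assumes "z ^ p = \<mu> * z" "\<mu> \<in> GF p" "\<mu> ^ n = 1" "of_nat n = (0 :: 'a)"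
  shows "frob_trace p n (z :: 'a) = 0"
proof -
  have "frob_trace p n z = (\<Sum>i<n. \<mu> ^ i) * z"
    using power_frob_eigen[OF assms(1,2)] by (simp add: frob_trace_def sum_distrib_right)
  moreover have "(\<Sum>i<n. \<mu> ^ i) = 0"
    using assms(3,4) geometric_sum[of \<mu> n] by (cases "\<mu> = 1") simp_all
  ultimately show ?thesis
    by simp
qed

text \<open>Since \<open>'a\<close> is algebraically closed, additive Hilbert 90 reduces to the telescoping sum above.\<close>

lemma card_frob_diff_fibre:
  "card {y \<in> GF (p ^ n). y ^ p - y = z} = (if frob_trace p n (z :: 'a) = 0 then p else 0)"
proof -
  define P where "P = monom (1 :: 'a) p + [:- z, - 1:]"
  have "degree P = p"
    unfolding P_def using p_gt_1 by (subst degree_add_eq_left) (simp_all add: degree_monom_eq)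
  then obtain y0 where "poly P y0 = 0"
    using alg_closed_imp_poly_has_root[of P] p_gt_1 by auto
  then have y0: "y0 ^ p - y0 = z"
    by (simp add: P_def poly_monom algebra_simps)
  \<comment> \<open>All solutions have the same value of y^(p^n) - y, so either all of them lie in
    \<open>GF (p ^ n)\<close> or none does.\<close>
  have trace: "frob_trace p n z = y ^ (p ^ n) - y" if "y ^ p - y = z" for y
    using frob_trace_frob_diff[of n y] that by simp
  show ?thesis
  proof (cases "frob_trace p n z = 0")
    case True
    have "{y \<in> GF (p ^ n). y ^ p - y = z} = {y. y ^ p - y = z}"
      using trace True by (auto simp: GF_def)
    moreover have "{y. y ^ p - y = z} = (+) y0 ` GF p"
    proof (intro Set.set_eqI iffI)
      fix y
      assume "y \<in> {y. y ^ p - y = z}"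
      then have "y - y0 \<in> GF p"
        using frob_diff[of y y0 1] y0 by (auto simp: GF_def algebra_simps)
      then show "y \<in> (+) y0 ` GF p"
        by (intro image_eqI[of _ _ "y - y0"]) auto
    next
      fix y
      assume "y \<in> (+) y0 ` GF p"
      then obtain t where "y = y0 + t" "t ^ p = t"
        by (auto simp: GF_def)
      then show "y \<in> {y. y ^ p - y = z}"
        using frob_add[of y0 t 1] y0 by (auto simp: algebra_simps)
    qed
    ultimately show ?thesis
      using True card_GF_p by (simp add: card_image)
  next
    case False
    then have "{y \<in> GF (p ^ n). y ^ p - y = z} = {}"
      using trace by (auto simp: GF_def)
    then show ?thesis
      using False by (simp only: card.empty if_False)
  qed
qed

text \<open>Summing over the fibres of x -> x^p - x. A trivial P gives the size of the trace kernel;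
  later P is the vanishing of the quadratic form.\<close>

lemma card_frob_diff_preimage:
  assumes "n > 0"
  shows "card {x \<in> GF (p ^ n). P (x ^ p - x :: 'a)} =
    p * card {z \<in> GF (p ^ n). frob_trace p n z = 0 \<and> P z}"
proof -
  let ?V = "GF (p ^ n) :: 'a set"
  have V: "finite ?V"
    by (rule finite_GF_power[OF assms])
  have "{x \<in> ?V. P (x ^ p - x)} = (\<Union>z\<in>{z \<in> ?V. P z}. {x \<in> ?V. x ^ p - x = z})"
    by (auto intro: GF_diff GF_power)
  then have "card {x \<in> ?V. P (x ^ p - x)} = (\<Sum>z\<in>{z \<in> ?V. P z}. card {x \<in> ?V. x ^ p - x = z})"
    using V by (simp, subst card_UN_disjoint) auto
  also have "\<dots> = (\<Sum>z\<in>{z \<in> ?V. P z}. if frob_trace p n z = 0 then p else 0)"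
    by (simp add: card_frob_diff_fibre)
  also have "\<dots> = p * card {z \<in> {z \<in> ?V. P z}. frob_trace p n z = 0}"
    using V by (simp flip: sum.inter_filter)
  also have "{z \<in> {z \<in> ?V. P z}. frob_trace p n z = 0} = {z \<in> ?V. frob_trace p n z = 0 \<and> P z}"
    by auto
  finally show ?thesis .
qed

lemma card_frob_trace_kernel:
  assumes "n > 0"
  shows "p * card {z \<in> GF (p ^ n). frob_trace p n (z :: 'a) = 0} = p ^ n"
  using card_frob_diff_preimage[OF assms, of "\<lambda>_. True"] card_GF_power[OF assms] by simp

text \<open>Multiplication by a nonzero c permutes \<open>GF (p ^ n)\<close>, so the trace would
  vanish identically, although its kernel has index p.\<close>

lemma frob_trace_nondegenerate:
  assumes "n > 0" "c \<in> GF (p ^ n)" "\<And>w. w \<in> GF (p ^ n) \<Longrightarrow> frob_trace p n (c * w :: 'a) = 0"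
  shows "c = 0"
proof (rule ccontr)
  assume c: "c \<noteq> 0"
  have "frob_trace p n z = 0" if "z \<in> GF (p ^ n)" for z :: 'a
    using assms(3)[of "z / c"] c that assms(2) by (simp add: GF_divide)
  then have "{z \<in> GF (p ^ n). frob_trace p n z = 0} = (GF (p ^ n) :: 'a set)"
    by auto
  then show False
    using card_frob_trace_kernel[OF assms(1)] card_GF_power[OF assms(1)] p_gt_1 by simp
qed

section \<open>Zeros of quadratic trace forms via isotropic subspaces\<close>

lemma card_linear_fibre:
  fixes g :: "'a \<Rightarrow> 'a"
  assumes W: "GF_subspace p W" "finite W"
    and add: "\<And>v w. v \<in> W \<Longrightarrow> w \<in> W \<Longrightarrow> g (v + w) = g v + g w"
    and scale: "\<And>t w. t \<in> GF p \<Longrightarrow> w \<in> W \<Longrightarrow> g (t * w) = t * g w"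
    and range: "\<And>w. w \<in> W \<Longrightarrow> g w \<in> GF p"
    and u: "u \<in> W" "g u \<noteq> 0" and a: "a \<in> GF p"
  shows "p * card {w \<in> W. g w = a} = card W"
proof -
  have neg: "- w \<in> W" "g (- w) = - g w" if "w \<in> W" for w
    using that W(1) scale[of "- 1" w] GF_p_closed(3)[OF GF_one]
    unfolding GF_subspace_def by (force, simp)
  have fibre: "card {w \<in> W. g w = b} = card {w \<in> W. g w = 0}" if b: "b \<in> GF p" for b
  proof -
    \<comment> \<open>A multiple of u with value b, available because g u is a nonzero scalar.
      Translation by it identifies the fibre over 0 with the fibre over b.\<close>
    define w0 where "w0 = (b / g u) * u"
    have t: "b / g u \<in> GF p"
      using b range[OF u(1)] by (rule GF_divide)
    have w0: "w0 \<in> W" "g w0 = b"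
      using t W(1) u scale[OF t u(1)] by (auto simp: w0_def GF_subspace_def)
    have "bij_betw (\<lambda>w. w + w0) {w \<in> W. g w = 0} {w \<in> W. g w = b}"
    proof (rule bij_betw_byWitness[of _ "\<lambda>w. w + - w0"])
      show "(\<lambda>w. w + w0) ` {w \<in> W. g w = 0} \<subseteq> {w \<in> W. g w = b}"
        using w0 W(1) by (auto simp: GF_subspace_def add)
      show "(\<lambda>w. w + - w0) ` {w \<in> W. g w = b} \<subseteq> {w \<in> W. g w = 0}"
        using w0 neg[OF w0(1)] W(1) add[OF _ neg(1)[OF w0(1)]]
        unfolding GF_subspace_def by auto
    qed auto
    then show ?thesis
      by (simp add: bij_betw_same_card)
  qed
  have "(\<Union>b\<in>GF p. {w \<in> W. g w = b}) = W"
    using range by auto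
  moreover have "card (\<Union>b\<in>GF p. {w \<in> W. g w = b}) = (\<Sum>b\<in>GF p. card {w \<in> W. g w = b})"
    using finite_GF_p W(2) by (intro card_UN_disjoint) auto
  ultimately have "card W = (\<Sum>b\<in>GF p. card {w \<in> W. g w = b})"
    by simp
  also have "\<dots> = (\<Sum>b\<in>(GF p :: 'a set). card {w \<in> W. g w = 0})"
    by (intro sum.cong refl fibre)
  finally show ?thesis
    using card_GF_p fibre[OF a] by simp
qed

text \<open>
  Double counting of the pairs \<open>(s, w)\<close> such that the form vanishes at \<open>s + w\<close>: on a coset of the
  isotropic subspace \<open>W\<close> the form is affine linear, and it is constant exactly when \<open>s\<close> is
  orthogonal to \<open>W\<close>.
\<close>

lemma card_isotropic:
  fixes W :: "'a set"
  assumes n: "n > 0" and \<gamma>: "\<gamma> \<in> GF (p ^ n)"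
    and W: "GF_subspace p W" "W \<subseteq> GF (p ^ n)"
    and isotropic: "\<And>w. w \<in> W \<Longrightarrow> frob_trace p n (\<gamma> * w\<^sup>2) = 0"
  defines "f \<equiv> \<lambda>s. frob_trace p n (\<gamma> * s\<^sup>2)"
    and "B \<equiv> \<lambda>s w. frob_trace p n (2 * \<gamma> * s * w)"
  shows "p * card {s \<in> GF (p ^ n). f s = 0} + card {s \<in> GF (p ^ n). \<forall>w\<in>W. B s w = 0} =
    p ^ n + p * card {s \<in> GF (p ^ n). (\<forall>w\<in>W. B s w = 0) \<and> f s = 0}"
proof -
  define V where "V = (GF (p ^ n) :: 'a set)"
  have V: "finite V" "card V = p ^ n" "\<And>x y. x \<in> V \<Longrightarrow> y \<in> V \<Longrightarrow> x + y \<in> V"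
      "\<And>x y. x \<in> V \<Longrightarrow> y \<in> V \<Longrightarrow> x - y \<in> V"
    using finite_GF_power[OF n] card_GF_power[OF n] GF_add GF_diff by (auto simp: V_def)
  have finW: "finite W"
    using W(2) V(1) finite_subset V_def by blast
  have W0: "card W > 0"
    using W(1) finW by (auto simp: GF_subspace_def card_gt_0_iff)
  have fV: "f s \<in> GF p" if "s \<in> V" for s
    unfolding f_def using that \<gamma> by (intro frob_trace_in_GF GF_mult GF_power) (auto simp: V_def)
  have BV: "B s w \<in> GF p" if "s \<in> V" "w \<in> W" for s w
    unfolding B_def using that \<gamma> GF_two W(2) by (intro frob_trace_in_GF GF_mult) (auto simp: V_def)
  \<comment> \<open>Polarisation: B is the polar form of f, and the term in w^2 vanishes by
    isotropy.\<close>
  have f_add: "f (s + w) = f s + B s w" if "w \<in> W" for s w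
    using isotropic[OF that]
    by (simp add: f_def B_def power2_sum ring_distribs frob_trace_add ac_simps)
  \<comment> \<open>The proportion of zeros on the coset s + W is 1 or 0 if s is orthogonal to W,
    and 1/p otherwise. The factor p keeps the count in the natural numbers.\<close>
  have fibre: "p * card {w \<in> W. f (s + w) = 0} =
      card W * (if \<forall>w\<in>W. B s w = 0 then if f s = 0 then p else 0 else 1)" if s: "s \<in> V" for s
  proof (cases "\<forall>w\<in>W. B s w = 0")
    case True
    then have "{w \<in> W. f (s + w) = 0} = (if f s = 0 then W else {})"
      by (auto simp: f_add)
    then show ?thesis
      using True by simp
  next
    case False
    then obtain w1 where w1: "w1 \<in> W" "B s w1 \<noteq> 0"
      by auto
    have "{w \<in> W. f (s + w) = 0} = {w \<in> W. B s w = - f s}"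
      by (auto simp: f_add add_eq_0_iff)
    moreover have "p * card {w \<in> W. B s w = - f s} = card W"
    proof (rule card_linear_fibre[where u = w1])
      show "- f s \<in> GF p"
        using fV[OF s] by (rule GF_p_closed)
      show "B s (v + w) = B s v + B s w" for v w
        by (simp add: B_def ring_distribs frob_trace_add)
      show "B s (t * w) = t * B s w" if "t \<in> GF p" for t w
        using frob_trace_scale[OF that, of n "2 * \<gamma> * s * w"] by (simp add: B_def ac_simps)
    qed (use BV[OF s] W(1) finW w1 in auto)
    ultimately show ?thesis
      using False by (subst if_not_P) auto
  qed
  let ?h = "\<lambda>s. if \<forall>w\<in>W. B s w = 0 then if f s = 0 then p else 0 else 1"
  have "(\<Sum>w\<in>W. card {s \<in> V. f (s + w) = 0}) = card W * card {s \<in> V. f s = 0}"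
  proof -
    have "card {s \<in> V. f (s + w) = 0} = card {s \<in> V. f s = 0}" if "w \<in> W" for w
    proof -
      have w: "w \<in> V"
        using that W(2) by (auto simp: V_def)
      have "bij_betw (\<lambda>s. s + w) {s \<in> V. f (s + w) = 0} {s \<in> V. f s = 0}"
        by (rule bij_betw_byWitness[of _ "\<lambda>s. s - w"]) (use w V in auto)
      then show ?thesis
        by (rule bij_betw_same_card)
    qed
    then show ?thesis
      by simp
  qed
  moreover have "(\<Sum>w\<in>W. card {s \<in> V. f (s + w) = 0}) = (\<Sum>s\<in>V. card {w \<in> W. f (s + w) = 0})"
    using sum.swap_restrict[OF finW V(1), of "\<lambda>_ _. 1 :: nat" "\<lambda>w s. f (s + w) = 0"]
    by (simp only: card_eq_sum)
  moreover have "p * (\<Sum>s\<in>V. card {w \<in> W. f (s + w) = 0}) = card W * (\<Sum>s\<in>V. ?h s)"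
    unfolding sum_distrib_left by (intro sum.cong refl fibre)
  ultimately have "p * (card W * card {s \<in> V. f s = 0}) = card W * (\<Sum>s\<in>V. ?h s)"
    by simp
  then have zeros: "p * card {s \<in> V. f s = 0} = (\<Sum>s\<in>V. ?h s)"
    using W0 by (simp add: mult.left_commute)
  \<comment> \<open>Adding 1 at each s orthogonal to W turns the weights p, 0, 1 into p + 1, 1, 1.
    The constant 1 sums to \<open>card V\<close>, and no subtraction occurs.\<close>
  have "(\<Sum>s\<in>V. ?h s) + card {s \<in> V. \<forall>w\<in>W. B s w = 0} =
      (\<Sum>s\<in>V. 1 + (if (\<forall>w\<in>W. B s w = 0) \<and> f s = 0 then p else 0))"
    unfolding card_eq_sum sum.inter_filter[OF V(1)] sum.distrib[symmetric]
    by (intro sum.cong) auto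
  also have "\<dots> = card V + (\<Sum>s\<in>V. if (\<forall>w\<in>W. B s w = 0) \<and> f s = 0 then p else 0)"
    by (simp only: sum.distrib card_eq_sum)
  also have "(\<Sum>s\<in>V. if (\<forall>w\<in>W. B s w = 0) \<and> f s = 0 then p else 0) =
      p * card {s \<in> V. (\<forall>w\<in>W. B s w = 0) \<and> f s = 0}"
    by (subst sum.inter_filter[OF V(1), symmetric]) simp
  finally show ?thesis
    using zeros V(2) by (simp add: V_def)
qed

text \<open>\<open>card_isotropic\<close> is used twice. The subspace W = e
  \<open>GF (p ^ m)\<close> equals its own orthogonal complement, which yields the number of zeros
  on the whole space. The line U spanned by 1 / \<gamma> has the hyperplane of trace 0 as
  complement, which turns that number into the number of zeros on the hyperplane.\<close>

lemma card_frob_trace_zeros: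
  fixes \<gamma> e :: 'a
  assumes m: "m > 0" and two: "(2 :: 'a) \<noteq> 0"
    and \<gamma>: "\<gamma> \<in> GF (p ^ (2 * m))" "\<gamma> \<noteq> 0" and e: "e \<in> GF (p ^ (2 * m))" "e \<noteq> 0"
    and anti: "(\<gamma> * e\<^sup>2) ^ (p ^ m) = - (\<gamma> * e\<^sup>2)"
    and inv: "frob_trace p (2 * m) (1 / \<gamma>) = 0"
  defines "tr \<equiv> frob_trace p (2 * m) :: 'a \<Rightarrow> 'a"
  shows "p * p * card {s \<in> GF (p ^ (2 * m)). tr s = 0 \<and> tr (\<gamma> * s\<^sup>2) = 0} + p * p ^ m =
    p * p * p ^ m + p ^ (2 * m)"
proof -
  define V where "V = (GF (p ^ (2 * m)) :: 'a set)"
  have n: "2 * m > 0"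
    using m by simp
  have frob_frob: "(x ^ (p ^ m)) ^ (p ^ m) = x ^ (p ^ (2 * m))" for x :: 'a
    by (simp add: mult_2 power_add power_mult)
  have sub: "b \<in> V" if "b \<in> GF (p ^ m)" for b
    using that frob_frob[of b] by (simp add: V_def GF_def)
  have tr_anti: "tr z = 0" if "z ^ (p ^ m) = - z" for z
    using that by (simp add: tr_def frob_trace_double frob_trace_0)
  have tr_eb: "tr (\<gamma> * e\<^sup>2 * b) = 0" if "b \<in> GF (p ^ m)" for b
    using that anti by (intro tr_anti) (simp add: power_mult_distrib[of "\<gamma> * e\<^sup>2"] GF_def)

  define W where "W = (*) e ` (GF (p ^ m) :: 'a set)"
  have WV: "W \<subseteq> V"
    using e(1) sub by (auto simp: W_def V_def intro: GF_mult)
  have isotropic: "tr (\<gamma> * w\<^sup>2) = 0" if w: "w \<in> W" for w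
  proof -
    obtain b where "w = e * b" "b \<in> GF (p ^ m)"
      using w by (auto simp: W_def)
    then show ?thesis
      using tr_eb[of "b\<^sup>2"] GF_power[of b "p ^ m" 2] by (simp add: power_mult_distrib ac_simps)
  qed
  have perp: "(\<forall>w\<in>W. tr (2 * \<gamma> * s * w) = 0) \<longleftrightarrow> s \<in> W" if s: "s \<in> V" for s
  proof
    assume "s \<in> W"
    then obtain b where b: "s = e * b" "b \<in> GF (p ^ m)"
      by (auto simp: W_def)
    show "\<forall>w\<in>W. tr (2 * \<gamma> * s * w) = 0"
    proof
      fix w
      assume "w \<in> W"
      then obtain c where c: "w = e * c" "c \<in> GF (p ^ m)"
        by (auto simp: W_def)
      have "2 * b * c \<in> GF (p ^ m)"
        using b(2) c(2) by (intro GF_mult GF_two)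
      from tr_eb[OF this] show "tr (2 * \<gamma> * s * w) = 0"
        by (simp add: b(1) c(1) power2_eq_square ac_simps)
    qed
  next
    assume orth: "\<forall>w\<in>W. tr (2 * \<gamma> * s * w) = 0"
    \<comment> \<open>Orthogonality to W says that the relative trace z + z^(p^m) pairs to 0 with
      all of \<open>GF (p ^ m)\<close>, so it is 0. Then z and \<gamma> e^2 both change sign under
      the p^m-power map, and their quotient 2 s / e is fixed.\<close>
    define z where "z = 2 * \<gamma> * s * e"
    have "z \<in> V"
      unfolding z_def V_def using s \<gamma> e by (intro GF_mult GF_two) (auto simp: V_def)
    then have "z + z ^ (p ^ m) \<in> GF (p ^ m)"
      by (simp add: GF_def V_def frob_add frob_frob add.commute)
    moreover have "frob_trace p m ((z + z ^ (p ^ m)) * b) = 0" if "b \<in> GF (p ^ m)" for b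
    proof -
      have "tr (z * b) = 0"
        using orth[unfolded W_def ball_simps, rule_format, OF that] by (simp add: z_def mult.assoc)
      then show ?thesis
        using that by (simp add: tr_def frob_trace_double power_mult_distrib GF_def distrib_right)
    qed
    ultimately have "z + z ^ (p ^ m) = 0"
      by (rule frob_trace_nondegenerate[OF m])
    then have z: "z ^ (p ^ m) = - z"
      by (simp add: add_eq_0_iff)
    have z_eq: "z = 2 * (\<gamma> * e\<^sup>2) * (s / e)"
      using e(2) by (simp add: z_def power2_eq_square)
    have "z ^ (p ^ m) = 2 * - (\<gamma> * e\<^sup>2) * (s / e) ^ (p ^ m)"
      unfolding z_eq power_mult_distrib[of _ "s / e"] power_mult_distrib[of 2] anti
      using GF_two[of m] by (simp add: GF_def)
    with z have "2 * (\<gamma> * e\<^sup>2) * (s / e) ^ (p ^ m) = 2 * (\<gamma> * e\<^sup>2) * (s / e)"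
      unfolding z_eq by simp
    moreover have "2 * (\<gamma> * e\<^sup>2) \<noteq> 0"
      using two \<gamma>(2) e(2) by simp
    ultimately have "(s / e) ^ (p ^ m) = s / e"
      using mult_left_cancel by blast
    then have "s / e \<in> GF (p ^ m)"
      unfolding GF_def by (rule CollectI)
    then show "s \<in> W"
      unfolding W_def using e(2) by (intro image_eqI[of _ _ "s / e"]) auto
  qed
  have cardW: "card W = p ^ m"
    unfolding W_def using e(2) card_GF_power[OF m] by (subst card_image) (auto simp: inj_on_def)
  have "{s \<in> V. \<forall>w\<in>W. tr (2 * \<gamma> * s * w) = 0} = W"
    using perp WV by blast
  moreover have "{s \<in> V. (\<forall>w\<in>W. tr (2 * \<gamma> * s * w) = 0) \<and> tr (\<gamma> * s\<^sup>2) = 0} = W"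
    using perp WV isotropic by blast
  moreover have "p * card {s \<in> V. tr (\<gamma> * s\<^sup>2) = 0}
      + card {s \<in> V. \<forall>w\<in>W. tr (2 * \<gamma> * s * w) = 0} = p ^ (2 * m)
      + p * card {s \<in> V. (\<forall>w\<in>W. tr (2 * \<gamma> * s * w) = 0) \<and> tr (\<gamma> * s\<^sup>2) = 0}"
    unfolding V_def tr_def
    by (rule card_isotropic[OF n \<gamma>(1)])
      (use WV isotropic GF_subspace_scale[OF GF_subspace_GF] in \<open>auto simp: V_def tr_def W_def\<close>)
  ultimately have zeros: "p * card {s \<in> V. tr (\<gamma> * s\<^sup>2) = 0} + p ^ m = p ^ (2 * m) + p * p ^ m"
    using cardW by simp

  \<comment> \<open>With w = t / \<gamma> the polar form becomes 2 t \<open>tr s\<close>, and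
    \<gamma> w^2 = t^2 / \<gamma> has trace 0 by \<open>inv\<close>.\<close>
  define U where "U = (*) (1 / \<gamma>) ` (GF p :: 'a set)"
  have GF_p: "GF p \<subseteq> V"
    using GF_subset_GF_power by (auto simp: V_def)
  have UV: "U \<subseteq> V"
    using \<gamma>(1) GF_p by (auto simp: U_def V_def intro: GF_divide)
  have isotropic': "tr (\<gamma> * w\<^sup>2) = 0" if w: "w \<in> U" for w
  proof -
    obtain t where t: "w = 1 / \<gamma> * t" "t \<in> GF p"
      using w by (auto simp: U_def)
    have "\<gamma> * w\<^sup>2 = t\<^sup>2 * (1 / \<gamma>)"
      using \<gamma>(2) by (simp add: t power2_eq_square)
    then show ?thesis
      using frob_trace_scale[OF GF_power[OF t(2), of 2], of "2 * m" "1 / \<gamma>"] inv by (simp add: tr_def)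
  qed
  have perp': "(\<forall>w\<in>U. tr (2 * \<gamma> * s * w) = 0) \<longleftrightarrow> tr s = 0" for s
  proof -
    have "tr (2 * \<gamma> * s * (1 / \<gamma> * t)) = 2 * t * tr s" if "t \<in> GF p" for t
    proof -
      have "2 * \<gamma> * s * (1 / \<gamma> * t) = (2 * t) * s"
        using \<gamma>(2) by simp
      moreover have "2 * t \<in> GF p"
        using GF_two[of 1] that by (intro GF_mult) simp_all
      ultimately show ?thesis
        unfolding tr_def by (simp only: frob_trace_scale)
    qed
    then show ?thesis
      unfolding U_def ball_simps using two GF_one[of p] by auto
  qed
  have "GF_subspace p U"
    unfolding U_def using GF_subspace_GF[of 1] by (intro GF_subspace_scale) simp
  then have "p * card {s \<in> V. tr (\<gamma> * s\<^sup>2) = 0}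
      + card {s \<in> V. \<forall>w\<in>U. tr (2 * \<gamma> * s * w) = 0} = p ^ (2 * m)
      + p * card {s \<in> V. (\<forall>w\<in>U. tr (2 * \<gamma> * s * w) = 0) \<and> tr (\<gamma> * s\<^sup>2) = 0}"
    unfolding V_def tr_def
    by (intro card_isotropic[OF n \<gamma>(1)]) (use UV isotropic' in \<open>auto simp: V_def tr_def\<close>)
  then have "p * card {s \<in> V. tr (\<gamma> * s\<^sup>2) = 0} + card {s \<in> V. tr s = 0} =
      p ^ (2 * m) + p * card {s \<in> V. tr s = 0 \<and> tr (\<gamma> * s\<^sup>2) = 0}"
    unfolding perp' .
  \<comment> \<open>One more factor p makes the known value of p times the size of the trace kernel
    applicable.\<close>
  from arg_cong[OF this, of "(*) p"] have "p * (p * card {s \<in> V. tr (\<gamma> * s\<^sup>2) = 0}) + p * card {s \<in> V. tr s = 0} =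
      p * p ^ (2 * m) + p * (p * card {s \<in> V. tr s = 0 \<and> tr (\<gamma> * s\<^sup>2) = 0})"
    by (simp only: distrib_left)
  moreover have "p * card {s \<in> V. tr s = 0} = p ^ (2 * m)"
    unfolding V_def tr_def by (rule card_frob_trace_kernel[OF n])
  moreover have "p * (p * card {s \<in> V. tr (\<gamma> * s\<^sup>2) = 0}) + p * p ^ m =
      p * p ^ (2 * m) + p * (p * p ^ m)"
    using arg_cong[OF zeros, of "(*) p"] by (simp only: distrib_left)
  ultimately show ?thesis
    unfolding V_def mult.assoc by linarith
qed

section \<open>From the curve to the trace form\<close>

text \<open>
  The substitution \<open>x = \<xi> t\<close>, \<open>y \<mapsto> y - \<zeta> (\<alpha> + 1) x\<^sup>2\<close> transforms the equation of the curve into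
  \<open>y^p - y = \<gamma> (t^p - t)\<^sup>2\<close>.
\<close>

lemma card_affine_points:
  fixes \<alpha> \<beta> \<xi> \<zeta> :: 'a
  assumes n: "n > 0" and \<alpha>: "\<alpha> \<in> GF p" and \<beta>: "\<beta> * (\<alpha> * (\<alpha> + 1)) = - 1"
    and \<xi>: "\<xi> \<noteq> 0" "\<xi> ^ p = \<alpha> * \<xi>" "\<xi> \<in> GF (p ^ n)"
    and \<zeta>: "\<zeta> ^ p = \<beta> * \<zeta>" "\<zeta> \<in> GF (p ^ n)"
  shows "card {(x, y). x \<in> GF (p ^ n) \<and> y \<in> GF (p ^ n) \<and>
      y ^ p - y = 2 * \<zeta> * x ^ (p + 1) + \<zeta> * x\<^sup>2} =
    p * p * card {s \<in> GF (p ^ n). frob_trace p n s = 0 \<and>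
      frob_trace p n (- \<zeta> * \<alpha> * \<xi>\<^sup>2 * s\<^sup>2) = 0}"
proof -
  define \<gamma> where "\<gamma> = - \<zeta> * \<alpha> * \<xi>\<^sup>2"
  define V where "V = (GF (p ^ n) :: 'a set)"
  define w where "w t = \<zeta> * (\<alpha> + 1) * (\<xi> * t)\<^sup>2" for t
  have V: "finite V"
    using finite_GF_power[OF n] by (simp add: V_def)
  have \<alpha>1: "\<alpha> + 1 \<in> GF p"
    using \<alpha> GF_one by (rule GF_p_closed)
  have "\<alpha> + 1 \<in> V"
    using \<alpha>1 GF_subset_GF_power by (auto simp: V_def)
  then have wV: "w t \<in> V" if "t \<in> V" for t
    unfolding w_def V_def using \<zeta>(2) \<xi>(3) that by (intro GF_mult GF_power) (auto simp: V_def)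
  \<comment> \<open>The relation between \<alpha> and \<beta> enters here: it turns the p-th power
    of \<open>w t\<close> into \<gamma> t^(2p). The other two terms of the square come from 2
    \<zeta> x^(p+1) = -2 \<gamma> t^(p+1) and \<zeta> x^2 - \<open>w t\<close> = \<gamma>
    t^2.\<close>
  have w_frob: "w t ^ p = \<gamma> * (t ^ p)\<^sup>2" for t
  proof -
    have "w t ^ p = \<zeta> ^ p * (\<alpha> + 1) ^ p * (\<xi> ^ p * t ^ p)\<^sup>2"
      by (simp add: w_def power_mult_distrib flip: power_mult) (simp add: mult.commute)
    also have "\<dots> = (\<beta> * (\<alpha> * (\<alpha> + 1))) * (\<zeta> * \<alpha> * \<xi>\<^sup>2 * (t ^ p)\<^sup>2)"
      using \<alpha>1 by (simp add: \<zeta>(1) \<xi>(2) GF_def power2_eq_square ac_simps)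
    also have "\<dots> = \<gamma> * (t ^ p)\<^sup>2"
      by (simp add: \<beta> \<gamma>_def)
    finally show ?thesis .
  qed
  have eq: "(y - w t) ^ p - (y - w t) = 2 * \<zeta> * (\<xi> * t) ^ (p + 1) + \<zeta> * (\<xi> * t)\<^sup>2 \<longleftrightarrow>
      y ^ p - y = \<gamma> * (t ^ p - t)\<^sup>2" for t y
  proof -
    have "2 * \<zeta> * (\<xi> * t) ^ (p + 1) + \<zeta> * (\<xi> * t)\<^sup>2 + \<gamma> * (t ^ p)\<^sup>2 - w t = \<gamma> * (t ^ p - t)\<^sup>2"
      by (simp add: \<gamma>_def w_def power_mult_distrib \<xi>(2) power2_eq_square algebra_simps)
    moreover have "(y - w t) ^ p = y ^ p - \<gamma> * (t ^ p)\<^sup>2"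
      using frob_diff[of y "w t" 1] by (simp add: w_frob)
    moreover have "a - (y - v) = b \<longleftrightarrow> x - y = d" if "b + c - v = d" "a = x - c" for a b c d v x :: 'a
    proof -
      have "(a - (y - v)) - b = (x - y) - d"
        unfolding that(2) that(1)[symmetric] by simp
      then show ?thesis
        by (metis right_minus_eq)
    qed
    ultimately show ?thesis
      by blast
  qed
  define A where "A = (SIGMA t:V. {y \<in> V. y ^ p - y = \<gamma> * (t ^ p - t)\<^sup>2})"
  define C where "C = {(x, y). x \<in> V \<and> y \<in> V \<and> y ^ p - y = 2 * \<zeta> * x ^ (p + 1) + \<zeta> * x\<^sup>2}"
  have \<xi>V: "\<xi> \<in> V"
    using \<xi>(3) by (simp add: V_def)
  have "bij_betw (\<lambda>(t, y). (\<xi> * t, y - w t)) A C"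
  proof (rule bij_betw_byWitness[of _ "\<lambda>(x, y). (x / \<xi>, y + w (x / \<xi>))"])
    show "\<forall>a\<in>A. (\<lambda>(x, y). (x / \<xi>, y + w (x / \<xi>))) ((\<lambda>(t, y). (\<xi> * t, y - w t)) a) = a"
      "\<forall>c\<in>C. (\<lambda>(t, y). (\<xi> * t, y - w t)) ((\<lambda>(x, y). (x / \<xi>, y + w (x / \<xi>))) c) = c"
      using \<xi>(1) by auto
    show "(\<lambda>(t, y). (\<xi> * t, y - w t)) ` A \<subseteq> C"
    proof (rule image_subsetI)
      fix a
      assume "a \<in> A"
      then obtain t y where a: "a = (t, y)" "t \<in> V" "y \<in> V" "y ^ p - y = \<gamma> * (t ^ p - t)\<^sup>2"
        by (auto simp: A_def)
      moreover have "\<xi> * t \<in> V" "y - w t \<in> V"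
        using \<xi>V a wV[OF a(2)] GF_diff[of y n] by (auto simp: V_def intro: GF_mult)
      ultimately show "(case a of (t, y) \<Rightarrow> (\<xi> * t, y - w t)) \<in> C"
        using eq[of y t] by (simp add: C_def)
    qed
    show "(\<lambda>(x, y). (x / \<xi>, y + w (x / \<xi>))) ` C \<subseteq> A"
    proof (rule image_subsetI)
      fix c
      assume "c \<in> C"
      then obtain x y where c: "c = (x, y)" "x \<in> V" "y \<in> V"
          "y ^ p - y = 2 * \<zeta> * x ^ (p + 1) + \<zeta> * x\<^sup>2"
        by (auto simp: C_def)
      moreover have t: "x / \<xi> \<in> V"
        using \<xi>V c by (auto simp: V_def intro: GF_divide)
      moreover have "y + w (x / \<xi>) \<in> V"
        using c wV[OF t] GF_add[of y n] by (auto simp: V_def)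
      ultimately show "(case c of (x, y) \<Rightarrow> (x / \<xi>, y + w (x / \<xi>))) \<in> A"
        using eq[of "y + w (x / \<xi>)" "x / \<xi>"] \<xi>(1) by (simp add: A_def)
    qed
  qed
  then have "card C = card A"
    by (simp add: bij_betw_same_card)
  \<comment> \<open>Each of the two factors p is the size of a nonempty fibre of v -> v^p - v, first
    for v = y and then for v = t.\<close>
  also have "card A = (\<Sum>t\<in>V. card {y \<in> V. y ^ p - y = \<gamma> * (t ^ p - t)\<^sup>2})"
    unfolding A_def using V by (intro card_SigmaI) auto
  also have "\<dots> = (\<Sum>t\<in>V. if frob_trace p n (\<gamma> * (t ^ p - t)\<^sup>2) = 0 then p else 0)"
    by (simp add: V_def card_frob_diff_fibre)
  also have "\<dots> = p * card {t \<in> V. frob_trace p n (\<gamma> * (t ^ p - t)\<^sup>2) = 0}"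
    by (subst sum.inter_filter[OF V, symmetric]) simp
  also have "card {t \<in> V. frob_trace p n (\<gamma> * (t ^ p - t)\<^sup>2) = 0} =
      p * card {s \<in> V. frob_trace p n s = 0 \<and> frob_trace p n (\<gamma> * s\<^sup>2) = 0}"
    unfolding V_def by (rule card_frob_diff_preimage[OF n])
  finally show ?thesis
    by (simp add: C_def V_def \<gamma>_def)
qed

text \<open>The common core of both cases, which differ only in m and e. The element \<gamma> is a
  Frobenius eigenvector with eigenvalue \<beta> \<alpha>^2, so \<open>anti\<close> says that
  \<gamma> e^2 changes sign under the p^m-power map, and \<open>char_dvd\<close> makes the trace of
  1 / \<gamma> vanish.\<close>

lemma maximal_curve_if_anti_invariant:
  fixes \<alpha> \<beta> \<xi> \<zeta> e :: 'a
  assumes m: "m > 0" and two: "(2 :: 'a) \<noteq> 0" and char_dvd: "of_nat (2 * m) = (0 :: 'a)"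
    and \<alpha>: "\<alpha> \<in> GF p" "\<alpha> \<noteq> 0" and \<beta>: "\<beta> * (\<alpha> * (\<alpha> + 1)) = - 1"
    and \<xi>: "\<xi> \<noteq> 0" "\<xi> ^ p = \<alpha> * \<xi>" and \<zeta>: "\<zeta> \<noteq> 0" "\<zeta> ^ p = \<beta> * \<zeta>"
    and order: "\<alpha> ^ (2 * m) = 1" "\<beta> ^ (2 * m) = 1"
    and e: "e \<in> GF (p ^ (2 * m))" "e \<noteq> 0"
    and anti: "(\<beta> * \<alpha>\<^sup>2) ^ m * (e\<^sup>2) ^ (p ^ m) = - (e\<^sup>2)"
  shows "maximal_curve p \<zeta> (p ^ (2 * m))"
proof -
  define n where "n = 2 * m"
  define \<gamma> where "\<gamma> = - \<zeta> * \<alpha> * \<xi>\<^sup>2"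
  define \<mu> where "\<mu> = \<beta> * \<alpha>\<^sup>2"
  have "\<beta> = - 1 / (\<alpha> * (\<alpha> + 1))"
    using \<beta> by (metis mult_zero_right neg_equal_0_iff_equal nonzero_eq_divide_eq zero_neq_one)
  then have \<beta>_GF: "\<beta> \<in> GF p"
    using \<alpha>(1) by (auto intro!: GF_divide GF_mult GF_one GF_p_closed)
  have "\<mu> ^ n = \<beta> ^ n * (\<alpha> ^ n)\<^sup>2"
    by (simp only: \<mu>_def power_mult_distrib power_mult[symmetric] mult.commute[of 2])
  then have \<mu>: "\<mu> \<in> GF p" "\<mu> ^ n = 1"
    using \<beta>_GF \<alpha>(1) order by (auto simp: \<mu>_def n_def intro: GF_mult GF_power)
  have \<xi>_GF: "\<xi> \<in> GF (p ^ n)" and \<zeta>_GF: "\<zeta> \<in> GF (p ^ n)"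
    using power_frob_eigen[OF \<xi>(2) \<alpha>(1), of n] power_frob_eigen[OF \<zeta>(2) \<beta>_GF, of n] order
    by (auto simp: GF_def n_def)
  have \<gamma>_frob: "\<gamma> ^ p = \<mu> * \<gamma>"
  proof -
    have "\<gamma> ^ p = - (\<zeta> ^ p * \<alpha> ^ p * (\<xi> ^ p)\<^sup>2)"
      using frob_minus[of "\<zeta> * \<alpha> * \<xi>\<^sup>2" 1]
      by (simp add: \<gamma>_def power_mult_distrib flip: power_mult) (simp add: mult.commute)
    then show ?thesis
      using \<alpha>(1) by (simp add: \<gamma>_def \<mu>_def \<zeta>(2) \<xi>(2) GF_def power2_eq_square ac_simps)
  qed
  have \<gamma>: "\<gamma> \<in> GF (p ^ n)" "\<gamma> \<noteq> 0"
    using power_frob_eigen[OF \<gamma>_frob \<mu>(1), of n] \<mu>(2) \<zeta>(1) \<xi>(1) \<alpha>(2) by (auto simp: GF_def \<gamma>_def)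
  have "(1 / \<gamma>) ^ p = (1 / \<mu>) * (1 / \<gamma>)"
    by (simp add: power_divide \<gamma>_frob)
  then have inv: "frob_trace p n (1 / \<gamma>) = 0"
    using \<mu> char_dvd by (intro frob_trace_eigen[of _ "1 / \<mu>"])
      (auto intro: GF_divide GF_one simp: power_divide n_def)
  have anti': "(\<gamma> * e\<^sup>2) ^ (p ^ m) = - (\<gamma> * e\<^sup>2)"
  proof -
    have "(\<gamma> * e\<^sup>2) ^ (p ^ m) = \<gamma> * (\<mu> ^ m * (e\<^sup>2) ^ (p ^ m))"
      by (simp only: power_mult_distrib[of \<gamma>] power_frob_eigen[OF \<gamma>_frob \<mu>(1)] ac_simps)
    then show ?thesis
      by (simp only: \<mu>_def anti mult_minus_right)
  qed
  have n: "n > 0"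
    using m by (simp add: n_def)
  have "card {(x, y). x \<in> GF (p ^ n) \<and> y \<in> GF (p ^ n) \<and>
      y ^ p - y = 2 * \<zeta> * x ^ (p + 1) + \<zeta> * x\<^sup>2} + p * p ^ m = p * p * p ^ m + p ^ n"
    using card_affine_points[OF n \<alpha>(1) \<beta> \<xi> \<xi>_GF \<zeta>(2) \<zeta>_GF]
      card_frob_trace_zeros[OF m two \<gamma>[unfolded n_def] e anti' inv[unfolded n_def]]
    by (simp add: \<gamma>_def n_def)
  then have "card (rational_points (complete_curve p \<zeta>) (p ^ n)) + p * p ^ m =
      p * p * p ^ m + p ^ n + 1"
    using card_rational_points[OF \<zeta>(1) two p_gt_1 _ finite_GF_power[OF n]] p_gt_1 by simp
  then have "real (card (rational_points (complete_curve p \<zeta>) (p ^ n)) + p * p ^ m) =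
      real (p * p * p ^ m + p ^ n + 1)"
    by (rule arg_cong)
  \<comment> \<open>The count is p^n + 1 + p (p - 1) p^m, where p (p - 1) is twice the genus and p^m
    is the square root of p^n.\<close>
  moreover have "sqrt (real (p ^ n)) = real p ^ m"
    by (simp add: n_def real_sqrt_power mult.commute[of 2] power_mult flip: real_sqrt_power)
  ultimately show ?thesis
    unfolding maximal_curve_def Let_def n_def[symmetric]
    using n \<zeta>_GF GF_subset_GF_power[of p n] by (auto simp: field_simps)
qed

end

section \<open>Orders of \<alpha> and \<beta>, and the two cases\<close>

lemma ord_GF_units:
  assumes "x \<in> GF q" "x \<noteq> 0"
  shows "x ^ group.ord (GF_units q) x = 1"
proof -
  interpret group "GF_units q :: 'a monoid"
    by (rule group_GF_units)
  have "x [^]\<^bsub>GF_units q\<^esub> k = x ^ k" for k :: nat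
    by (induction k) (simp_all add: GF_units_def mult.commute)
  then show ?thesis
    using pow_ord_eq_1[of x] assms by (simp add: GF_units_def)
qed

theorem theorem7p6:
  fixes \<alpha> \<beta> \<xi> \<zeta> :: "'a :: alg_closed_field" and p0 k p d1 d2 d :: nat
  assumes "prime p0" and "odd p0" and "CHAR('a) = p0"
    and "algebraic_over_prime_field TYPE('a)"
    and "k > 0" and "p = p0 ^ k"
    and "\<alpha> \<in> GF p" and "\<alpha> \<noteq> 0" and "\<alpha> \<noteq> - 1"
    and "\<beta> = - inverse (\<alpha> * (\<alpha> + 1))"
    and "\<xi> \<noteq> 0" and "\<xi> ^ (p - 1) = \<alpha>"
    and "\<zeta> \<noteq> 0" and "\<zeta> ^ (p - 1) = \<beta>"
    and "d1 = group.ord (GF_units p) \<alpha>"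
    and "d2 = group.ord (GF_units p) \<beta>"
    and "d = lcm d1 d2"
  shows "(odd d \<and> p mod 4 = 3 \<longrightarrow> maximal_curve p \<zeta> (p ^ (2 * p0 * d))) \<and>
    (even d \<and> \<beta> ^ (d div 2) = - 1 \<longrightarrow> maximal_curve p \<zeta> (p ^ (p0 * d)))"
proof -
  have char_pos: "CHAR('a) > 0" and p_eq: "p = CHAR('a) ^ k"
    using assms(1,3,6) prime_gt_0_nat by auto
  note frobenius = char_pos p_eq \<open>k > 0\<close>
  have p: "p > 1"
    by (rule p_gt_1[OF frobenius])
  have two: "(2 :: 'a) \<noteq> 0"
    using assms(1-3) of_nat_eq_0_iff_char_dvd[where ?'a = 'a, of 2] primes_dvd_imp_eq[of p0 2] by auto
  have of_nat_p0: "of_nat (p0 * j) = (0 :: 'a)" for j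
    using assms(3) by (simp add: of_nat_eq_0_iff_char_dvd)
  have \<alpha>1: "\<alpha> + 1 \<noteq> 0"
    using \<open>\<alpha> \<noteq> - 1\<close> by (simp add: add_eq_0_iff2)
  have \<beta>: "\<beta> * (\<alpha> * (\<alpha> + 1)) = - 1"
    unfolding assms(10) mult_minus_left using \<alpha>1 \<open>\<alpha> \<noteq> 0\<close> by (simp only: left_inverse mult_eq_0_iff simp_thms)
  have "\<beta> = - 1 / (\<alpha> * (\<alpha> + 1))"
    by (simp add: assms(10) field_simps)
  then have \<beta>_GF: "\<beta> \<in> GF p" "\<beta> \<noteq> 0"
    using \<open>\<alpha> \<in> GF p\<close> \<beta> by (auto intro!: GF_divide GF_mult GF_one GF_p_closed[OF frobenius])
  have frob: "x ^ p = x ^ (p - 1) * x" for x :: 'a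
    using p by (simp flip: power_Suc2)
  have \<xi>: "\<xi> ^ p = \<alpha> * \<xi>" and \<zeta>: "\<zeta> ^ p = \<beta> * \<zeta>"
    using frob assms(12,14) by metis+
  have "\<alpha> ^ d1 = 1" "\<beta> ^ d2 = 1"
    using ord_GF_units assms(7,8,15,16) \<beta>_GF by auto
  moreover have "x ^ d = 1" if "x ^ j = 1" "j dvd d" for x :: 'a and j
    using that by (auto simp: power_mult)
  moreover have "d1 dvd d" "d2 dvd d"
    using assms(17) by simp_all
  ultimately have pow: "\<alpha> ^ d = 1" "\<beta> ^ d = 1"
    by blast+
  have pow_mult: "\<alpha> ^ (j * d) = 1" "\<beta> ^ (j * d) = 1" for j
    using pow by (simp_all add: power_mult mult.commute[of j])
  note maximal = maximal_curve_if_anti_invariant[OF frobenius _ two _ assms(7,8) \<beta> assms(11) \<xi> assms(13) \<zeta>]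
  have "maximal_curve p \<zeta> (p ^ (2 * p0 * d))" if case1: "odd d" "p mod 4 = 3"
  proof -
    define m where "m = p0 * d"
    have m: "m > 0" "odd m"
      using case1(1) \<open>odd p0\<close> by (auto simp: m_def odd_pos)
    \<comment> \<open>As p is 3 modulo 4, Frobenius negates i, and so does its m-th iterate because
      m is odd. Hence (1 + i)^2 = 2 i changes sign, while (\<beta> \<alpha>^2)^m = 1 because d
      divides m; so e = 1 + i serves.\<close>
    obtain i :: 'a where i: "i\<^sup>2 = - 1"
      using nth_root_exists[of 2 "- 1 :: 'a"] by auto
    have i4: "i ^ 4 = 1"
      using power_mult[of i 2 2] i by simp
    obtain j where "p = 4 * j + 3"
      using case1(2) mult_div_mod_eq[of 4 p] by metis
    then have "i ^ p = (i ^ 4) ^ j * (i\<^sup>2 * i)"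
      by (simp only: power_add power_mult power2_eq_square power3_eq_cube)
    then have "i ^ p = - 1 * i"
      by (simp add: i i4)
    moreover have "- 1 \<in> (GF p :: 'a set)"
      by (intro GF_p_closed[OF frobenius] GF_one)
    ultimately have i_frob: "i ^ (p ^ l) = (- 1) ^ l * i" for l
      by (rule power_frob_eigen)
    have e_sq: "(1 + i)\<^sup>2 = 2 * i"
      by (simp add: power2_sum i)
    have "i \<in> GF (p ^ (2 * m))"
      using i_frob[of "2 * m"] by (simp add: GF_def)
    then have "1 + i \<in> GF (p ^ (2 * m))"
      by (intro GF_add[OF frobenius] GF_one)
    moreover have "1 + i \<noteq> 0"
      using e_sq two i by auto
    moreover have "(\<beta> * \<alpha>\<^sup>2) ^ m * ((1 + i)\<^sup>2) ^ (p ^ m) = - ((1 + i)\<^sup>2)"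
    proof -
      have "(\<beta> * \<alpha>\<^sup>2) ^ m = 1"
        using pow_mult[of p0] pow_mult[of "2 * p0"]
        by (simp add: m_def power_mult_distrib ac_simps flip: power_mult)
      moreover have "(2 * i) ^ (p ^ m) = - (2 * i)"
        using GF_two[OF frobenius, of m] i_frob[of m] m(2) by (simp add: power_mult_distrib GF_def)
      ultimately show ?thesis
        by (simp add: e_sq)
    qed
    moreover have "2 * m = 2 * p0 * d" "2 * m = p0 * (2 * d)"
      by (simp_all add: m_def)
    then have "of_nat (2 * m) = (0 :: 'a)" "\<alpha> ^ (2 * m) = 1" "\<beta> ^ (2 * m) = 1"
      using pow_mult of_nat_p0 by metis+
    ultimately have "maximal_curve p \<zeta> (p ^ (2 * m))"
      using m(1) by (intro maximal)
    then show ?thesis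
      by (simp add: m_def ac_simps)
  qed
  moreover have "maximal_curve p \<zeta> (p ^ (p0 * d))" if "even d" "\<beta> ^ (d div 2) = - 1"
  proof -
    \<comment> \<open>Here \<beta>^m = (-1)^p0 = -1 as p0 is odd, and \<alpha>^(2m) = 1. Thus
      \<gamma> itself changes sign and e = 1 serves.\<close>
    define m where "m = p0 * (d div 2)"
    have m2: "2 * m = p0 * d"
      using that(1) by (simp add: m_def)
    \<comment> \<open>The exponent 0 would give 1 = -1, although 2 is nonzero.\<close>
    have "d div 2 > 0"
      using that(2) two by (intro gr0I) auto
    then have m: "m > 0"
      using \<open>odd p0\<close> by (simp add: m_def odd_pos)
    have "\<beta> ^ m = - 1"
      using that(2) \<open>odd p0\<close> by (simp add: m_def power_mult mult.commute[of p0])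
    moreover have "(\<alpha>\<^sup>2) ^ m = 1"
      using pow_mult[of p0] by (simp add: m2 flip: power_mult)
    ultimately have "(\<beta> * \<alpha>\<^sup>2) ^ m * (1\<^sup>2) ^ (p ^ m) = - (1\<^sup>2)"
      by (simp add: power_mult_distrib)
    then have "maximal_curve p \<zeta> (p ^ (2 * m))"
      using m pow_mult[of p0] of_nat_p0[of d] GF_one
      by (intro maximal[of m 1]) (simp_all only: m2 zero_neq_one not_False_eq_True one_neq_zero)
    then show ?thesis
      by (simp add: m2)
  qed
  ultimately show ?thesis
    by blast
qed

end
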